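(* Let $V$ be a source component and let $A\in\mathcal{A}$ be an attacker context. Then $A\in\mathsf{TExploit}(V)$ if and only if there exists a trace property $\pi\subseteq\mathsf{Trace}^S$ such that $B(A[{\downarrow}V])\not\subseteq{\downarrow}\pi$ but $B(C[V])\subseteq\pi$ for all source contexts $C$.
   Context: There are two languages, a source language and a target language. Each has whole programs, components, contexts, and a set of traces ($\mathsf{Trace}^S$ for the source, $\mathsf{Trace}^T$ for the target); behaviors are sets of traces, i.e. $\mathcal{B}^S=\mathcal{P}(\mathsf{Trace}^S)$ and $\mathcal{B}^T=\mathcal{P}(\mathsf{Trace}^T)$. Linking a context $C$ with a component $U$ of the same language gives a whole program $C[U]$ (assumed always well-defined). Each whole program $P$ has a behavior $B(P)$, a set of traces of its language. A compiler ${\downarrow}$ maps source whole programs, components and contexts to target whole programs, components and contexts respectively, and is modular: $B({\downarrow}(C[U]))=B({\downarrow}C[{\downarrow}U])$ for all source contexts $C$ and source components $U$. An arbitrary relation $\mapsto$ between $\mathsf{Trace}^S$ and $\mathsf{Trace}^T$ is given. A set $\mathcal{A}$ of target contexts (the attackers) is fixed. For $\pi\subseteq\mathsf{Trace}^S$, $${\downarrow}\pi=\{t^T\in\mathsf{Trace}^T\mid\exists\,t^S\in\pi,\ t^S\mapsto t^T\}.$$ The set of trace exploits of a source component $V$ is $$\mathsf{TExploit}(V)=\{A\in\mathcal{A}\mid \exists\,t^T\in B(A[{\downarrow}V]).\ \forall \text{ source contexts } C.\ \forall t^S\in B(C[V]).\ t^S\not\mapsto t^T\}.$$ *)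

theory Defs
  imports Main
begin

record ('prog, 'comp, 'ctx, 'trace) language =
  link :: "'ctx \<Rightarrow> 'comp \<Rightarrow> 'prog"
  behavior :: "'prog \<Rightarrow> 'trace set"

record ('sprog, 'scomp, 'sctx, 'tprog, 'tcomp, 'tctx) compiler =
  compile_prog :: "'sprog \<Rightarrow> 'tprog"
  compile_comp :: "'scomp \<Rightarrow> 'tcomp"
  compile_ctx :: "'sctx \<Rightarrow> 'tctx"

definition modular_compiler ::
  "('sprog, 'scomp, 'sctx, 'strace) language \<Rightarrow>
   ('tprog, 'tcomp, 'tctx, 'ttrace) language \<Rightarrow>
   ('sprog, 'scomp, 'sctx, 'tprog, 'tcomp, 'tctx) compiler \<Rightarrow> bool" where
  "modular_compiler S T K \<longleftrightarrow>
    (\<forall>C U. behavior T (compile_prog K (link S C U)) =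
           behavior T (link T (compile_ctx K C) (compile_comp K U)))"

definition compile_property ::
  "('strace \<Rightarrow> 'ttrace \<Rightarrow> bool) \<Rightarrow> 'strace set \<Rightarrow> 'ttrace set" where
  "compile_property rel \<pi> = {t\<^sub>T. \<exists>t\<^sub>S\<in>\<pi>. rel t\<^sub>S t\<^sub>T}"

definition TExploit ::
  "('sprog, 'scomp, 'sctx, 'strace) language \<Rightarrow>
   ('tprog, 'tcomp, 'tctx, 'ttrace) language \<Rightarrow>
   ('sprog, 'scomp, 'sctx, 'tprog, 'tcomp, 'tctx) compiler \<Rightarrow>
   ('strace \<Rightarrow> 'ttrace \<Rightarrow> bool) \<Rightarrow> 'tctx set \<Rightarrow> 'scomp \<Rightarrow> 'tctx set" where
  "TExploit S T K rel Att V =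
    {A \<in> Att. \<exists>t\<^sub>T \<in> behavior T (link T A (compile_comp K V)).
       \<forall>C. \<forall>t\<^sub>S \<in> behavior S (link S C V). \<not> rel t\<^sub>S t\<^sub>T}"

end

theory Submission
  imports Defs
begin

text \<open>The union of the behaviors of \<open>V\<close> over all source contexts is the least
  trace property that \<open>V\<close> satisfies in every context. An exploit is exactly a target
  trace outside the image of this union under \<open>rel\<close>. Since
  \<open>compile_property rel\<close> is monotone, a trace missed by the image of any larger
  property is also missed by the image of the union.\<close>

theorem mainTheorem5:
  fixes S :: "('sprog, 'scomp, 'sctx, 'strace) language"
    and T :: "('tprog, 'tcomp, 'tctx, 'ttrace) language"
    and K :: "('sprog, 'scomp, 'sctx, 'tprog, 'tcomp, 'tctx) compiler"
    and rel :: "'strace \<Rightarrow> 'ttrace \<Rightarrow> bool"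
    and Att :: "'tctx set"
    and V :: 'scomp
    and A :: 'tctx
  assumes "modular_compiler S T K"
    and "A \<in> Att"
  shows "A \<in> TExploit S T K rel Att V \<longleftrightarrow>
    (\<exists>\<pi> :: 'strace set.
       \<not> behavior T (link T A (compile_comp K V)) \<subseteq> compile_property rel \<pi> \<and>
       (\<forall>C. behavior S (link S C V) \<subseteq> \<pi>))"
proof
  assume "A \<in> TExploit S T K rel Att V"
  \<comment> \<open>The union is the witness for \<open>\<pi>\<close>: the exploit trace is related
    to none of its elements.\<close>
  then have "\<not> behavior T (link T A (compile_comp K V))
      \<subseteq> compile_property rel (\<Union>C. behavior S (link S C V))"
    unfolding TExploit_def compile_property_def by blast
  then show "\<exists>\<pi>. \<not> behavior T (link T A (compile_comp K V)) \<subseteq> compile_property rel \<pi> \<and>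
      (\<forall>C. behavior S (link S C V) \<subseteq> \<pi>)"
    by blast
next
  assume "\<exists>\<pi>. \<not> behavior T (link T A (compile_comp K V)) \<subseteq> compile_property rel \<pi> \<and>
      (\<forall>C. behavior S (link S C V) \<subseteq> \<pi>)"
  \<comment> \<open>A target trace outside the image of \<open>\<pi>\<close> is related to nothing
    in \<open>\<pi>\<close>, hence to no source trace of \<open>V\<close> in any context.\<close>
  then show "A \<in> TExploit S T K rel Att V"
    using \<open>A \<in> Att\<close> unfolding TExploit_def compile_property_def by blast
qed

end
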